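(* Let $k\ge 1$, let $\mathcal{G}_1,\ldots,\mathcal{G}_k$ be ordered graphs, each containing at least one edge, let $\boldsymbol{\lambda}=(\lambda_1,\ldots,\lambda_k)\in(0,\infty)^k$, and put $R=\overline{\mathrm{R}}(\mathcal{G}_1,\ldots,\mathcal{G}_k)$, $h_i=v(\mathcal{G}_i)$, $h_*=\min_{i\in[k]}h_i$, $I_*=\{i\in[k]:h_i=h_*\}$ and $\lambda_*=\min_{j\in I_*}\lambda_j$. For $n\ge R$, the sequence $$\frac{\overline{\mathrm{M}}_{\boldsymbol{\lambda}}(n;\mathcal{G}_1,\ldots,\mathcal{G}_k)}{\binom{n}{h_*}}$$ is nondecreasing in $n$ and bounded above by $\lambda_*$. Therefore the limit $$\pi_{\boldsymbol{\lambda}}(\mathcal{G}_1,\ldots,\mathcal{G}_k):=\lim_{n\to\infty}\frac{\overline{\mathrm{M}}_{\boldsymbol{\lambda}}(n;\mathcal{G}_1,\ldots,\mathcal{G}_k)}{\binom{n}{h_*}}$$ exists and satisfies $$0<\frac{\overline{\mathrm{RM}}_{\boldsymbol{\lambda}}(\mathcal{G}_1,\ldots,\mathcal{G}_k)}{\binom{R}{h_*}}\le\pi_{\boldsymbol{\lambda}}(\mathcal{G}_1,\ldots,\mathcal{G}_k)\le\lambda_*.$$ In particular, $\overline{\mathrm{M}}_{\boldsymbol{\lambda}}(n;\mathcal{G}_1,\ldots,\mathcal{G}_k)=\Theta(n^{h_*})$ as $n\to\infty$.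
   Context: An ordered graph is a pair $\mathcal{G}=(G,<_{\mathcal{G}})$ where $G$ is a finite graph and $<_{\mathcal{G}}$ is a linear order on $V(G)$; $v(\mathcal{G})$ is its number of vertices. $[k]=\{1,\ldots,k\}$. $\mathcal{K}_n$ is the complete graph on $[n]$ with the natural order. An order-preserving copy of an ordered graph $\mathcal{H}$ in $\mathcal{G}$ is an injective map $V(\mathcal{H})\to V(\mathcal{G})$ that preserves the vertex order and maps every edge of $\mathcal{H}$ to an edge of $\mathcal{G}$; copies are counted by their vertex sets (an $h$-element vertex set supports at most one copy of a fixed $h$-vertex ordered graph). For a coloring $\chi:E(\mathcal{K}_n)\to[k]$, $N_i(\chi;\mathcal{G}_i)$ is the number of order-preserving copies of $\mathcal{G}_i$ in $\mathcal{K}_n$ all of whose edges have color $i$. The ordered Ramsey number $\overline{\mathrm{R}}(\mathcal{G}_1,\ldots,\mathcal{G}_k)$ is the least $N$ such that every $k$-edge-coloring of $\mathcal{K}_N$ contains an order-preserving copy of $\mathcal{G}_i$ in color $i$ for some $i\in[k]$. The weighted ordered multiplicity function is $$\overline{\mathrm{M}}_{\boldsymbol{\lambda}}(n;\mathcal{G}_1,\ldots,\mathcal{G}_k)=\min_{\chi:E(\mathcal{K}_n)\to[k]}\sum_{i=1}^{k}\lambda_iN_i(\chi;\mathcal{G}_i),$$ and the weighted threshold multiplicity is $\overline{\mathrm{RM}}_{\boldsymbol{\lambda}}(\mathcal{G}_1,\ldots,\mathcal{G}_k)=\overline{\mathrm{M}}_{\boldsymbol{\lambda}}(R;\mathcal{G}_1,\ldots,\mathcal{G}_k)$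 with $R=\overline{\mathrm{R}}(\mathcal{G}_1,\ldots,\mathcal{G}_k)$. *)

theory Defs
  imports Complex_Main "HOL-Library.FuncSet" "HOL-Library.Landau_Symbols"
begin

record 'a ordered_graph =
  verts :: "'a set"
  edges :: "'a set set"
  less_rel :: "('a \<times> 'a) set"

text \<open>
  Finite simple graphs; edges are two-element sets of vertices, and the order is given in its
  strict form, as a set of pairs.
\<close>
definition is_ordered_graph :: "'a ordered_graph \<Rightarrow> bool" where
  "is_ordered_graph G \<longleftrightarrow>
     finite (verts G) \<and>
     edges G \<subseteq> {e. e \<subseteq> verts G \<and> card e = 2} \<and>
     less_rel G \<subseteq> verts G \<times> verts G \<and>
     strict_linear_order_on (verts G) (less_rel G)"

definition order_of :: "'a ordered_graph \<Rightarrow> nat" where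
  "order_of G = card (verts G)"

definition complete_og :: "nat \<Rightarrow> nat ordered_graph" where
  "complete_og n =
     \<lparr>verts = {1..n},
      edges = {e. e \<subseteq> {1..n} \<and> card e = 2},
      less_rel = {(x, y). x \<in> {1..n} \<and> y \<in> {1..n} \<and> x < y}\<rparr>"

definition order_preserving_copy ::
    "'a ordered_graph \<Rightarrow> 'b ordered_graph \<Rightarrow> ('a \<Rightarrow> 'b) \<Rightarrow> bool" where
  "order_preserving_copy H G f \<longleftrightarrow>
     f \<in> verts H \<rightarrow> verts G \<and> inj_on f (verts H) \<and>
     (\<forall>x y. (x, y) \<in> less_rel H \<longrightarrow> (f x, f y) \<in> less_rel G) \<and>
     (\<forall>e\<in>edges H. f ` e \<in> edges G)"

text \<open>
  Colorings are extensional functions, so that for given \<open>n\<close> and \<open>k\<close> there are only finitely many.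
\<close>
definition colorings :: "nat \<Rightarrow> nat \<Rightarrow> (nat set \<Rightarrow> nat) set" where
  "colorings k n = edges (complete_og n) \<rightarrow>\<^sub>E {1..k}"

definition mono_copy ::
    "nat \<Rightarrow> (nat set \<Rightarrow> nat) \<Rightarrow> nat \<Rightarrow> 'a ordered_graph \<Rightarrow> ('a \<Rightarrow> nat) \<Rightarrow> bool" where
  "mono_copy n \<chi> i G f \<longleftrightarrow>
     order_preserving_copy G (complete_og n) f \<and> (\<forall>e\<in>edges G. \<chi> (f ` e) = i)"

text \<open>Copies are counted by their vertex sets.\<close>
definition num_mono_copies ::
    "nat \<Rightarrow> (nat set \<Rightarrow> nat) \<Rightarrow> nat \<Rightarrow> 'a ordered_graph \<Rightarrow> nat" where
  "num_mono_copies n \<chi> i G = card {f ` verts G | f. mono_copy n \<chi> i G f}"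

text \<open>
  For finite ordered graphs such an \<open>N\<close> exists by Ramsey's theorem, so the \<open>LEAST\<close> is meaningful.
\<close>
definition ordered_ramsey :: "nat \<Rightarrow> (nat \<Rightarrow> 'a ordered_graph) \<Rightarrow> nat" where
  "ordered_ramsey k G =
     (LEAST N. \<forall>\<chi>\<in>colorings k N. \<exists>i\<in>{1..k}. \<exists>f. mono_copy N \<chi> i (G i) f)"

definition ordered_mult ::
    "nat \<Rightarrow> (nat \<Rightarrow> real) \<Rightarrow> nat \<Rightarrow> (nat \<Rightarrow> 'a ordered_graph) \<Rightarrow> real" where
  "ordered_mult k w n G =
     Min ((\<lambda>\<chi>. \<Sum>i\<in>{1..k}. w i * real (num_mono_copies n \<chi> i (G i))) ` colorings k n)"

definition threshold_mult ::
    "nat \<Rightarrow> (nat \<Rightarrow> real) \<Rightarrow> (nat \<Rightarrow> 'a ordered_graph) \<Rightarrow> real" where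
  "threshold_mult k w G = ordered_mult k w (ordered_ramsey k G) G"

definition min_order :: "nat \<Rightarrow> (nat \<Rightarrow> 'a ordered_graph) \<Rightarrow> nat" where
  "min_order k G = Min ((\<lambda>i. order_of (G i)) ` {1..k})"

definition min_weight :: "nat \<Rightarrow> (nat \<Rightarrow> real) \<Rightarrow> (nat \<Rightarrow> 'a ordered_graph) \<Rightarrow> real" where
  "min_weight k w G = Min (w ` {i \<in> {1..k}. order_of (G i) = min_order k G})"

definition mult_ratio ::
    "nat \<Rightarrow> (nat \<Rightarrow> real) \<Rightarrow> (nat \<Rightarrow> 'a ordered_graph) \<Rightarrow> nat \<Rightarrow> real" where
  "mult_ratio k w G n = ordered_mult k w n G / real (n choose min_order k G)"

definition mult_limit :: "nat \<Rightarrow> (nat \<Rightarrow> real) \<Rightarrow> (nat \<Rightarrow> 'a ordered_graph) \<Rightarrow> real" where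
  "mult_limit k w G = lim (mult_ratio k w G)"

end

theory Submission
  imports Defs "HOL-Library.Ramsey"
begin

text \<open>
  Deleting a uniformly random vertex from a coloring of \<open>K\<^sub>n\<^sub>+\<^sub>1\<close> destroys each copy of \<open>G\<^sub>i\<close> with
  probability \<open>h\<^sub>i / (n + 1) \<ge> h\<^sub>* / (n + 1)\<close>, so an average deletion leaves at most the fraction
  \<open>(n + 1 - h\<^sub>*) / (n + 1)\<close> of the weight; this is exactly the quotient of the two binomial
  coefficients, which gives monotonicity. Coloring everything with the cheapest color among those of
  smallest order gives the upper bound, since no \<open>G\<^sub>i\<close> is edgeless. At the Ramsey number every coloring has positive weight.
\<close>

section \<open>Copies as finite families of vertex sets; minima over finitely many colorings\<close>

definition copy_sets ::
    "nat \<Rightarrow> (nat set \<Rightarrow> nat) \<Rightarrow> nat \<Rightarrow> 'a ordered_graph \<Rightarrow> nat set set" where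
  "copy_sets n \<chi> i G = {f ` verts G | f. mono_copy n \<chi> i G f}"

definition copy_weight ::
    "nat \<Rightarrow> (nat \<Rightarrow> real) \<Rightarrow> nat \<Rightarrow> (nat \<Rightarrow> 'a ordered_graph) \<Rightarrow> (nat set \<Rightarrow> nat) \<Rightarrow> real" where
  "copy_weight k w n G \<chi> = (\<Sum>i\<in>{1..k}. w i * real (num_mono_copies n \<chi> i (G i)))"

lemma num_mono_copies_eq_card: "num_mono_copies n \<chi> i G = card (copy_sets n \<chi> i G)"
  by (simp add: num_mono_copies_def copy_sets_def)

lemma verts_complete_og [simp]: "verts (complete_og n) = {1..n}"
  and less_rel_complete_og:
    "(x, y) \<in> less_rel (complete_og n) \<longleftrightarrow> x \<in> {1..n} \<and> y \<in> {1..n} \<and> x < y"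
  and edges_complete_og: "e \<in> edges (complete_og n) \<longleftrightarrow> e \<subseteq> {1..n} \<and> card e = 2"
  by (simp_all add: complete_og_def)

lemma mono_copyD:
  assumes "mono_copy n \<chi> i G f"
  shows "f ` verts G \<subseteq> {1..n}" "inj_on f (verts G)"
  using assms by (auto simp: mono_copy_def order_preserving_copy_def)

lemma copy_sets_subset: "copy_sets n \<chi> i G \<subseteq> {T. T \<subseteq> {1..n} \<and> card T = order_of G}"
proof
  fix T assume "T \<in> copy_sets n \<chi> i G"
  then obtain f where "T = f ` verts G" and f: "mono_copy n \<chi> i G f"
    by (auto simp: copy_sets_def)
  then show "T \<in> {T. T \<subseteq> {1..n} \<and> card T = order_of G}"
    using mono_copyD[OF f] by (simp add: order_of_def card_image)
qed

lemma finite_copy_sets [simp]: "finite (copy_sets n \<chi> i G)"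
  by (rule finite_subset[of _ "Pow {1..n}"]) (use copy_sets_subset in blast, simp)

lemma num_mono_copies_le: "num_mono_copies n \<chi> i G \<le> n choose order_of G"
proof -
  have "card (copy_sets n \<chi> i G) \<le> card {T. T \<subseteq> {1..n} \<and> card T = order_of G}"
    by (intro card_mono copy_sets_subset) simp
  then show ?thesis
    by (simp add: num_mono_copies_eq_card n_subsets)
qed

lemma num_mono_copies_pos:
  assumes "mono_copy n \<chi> i G f"
  shows "num_mono_copies n \<chi> i G > 0"
proof -
  have "f ` verts G \<in> copy_sets n \<chi> i G"
    using assms by (auto simp: copy_sets_def)
  then show ?thesis
    by (auto simp: num_mono_copies_eq_card card_gt_0_iff)
qed

lemma finite_colorings [simp]: "finite (colorings k n)"
proof -
  have "finite (edges (complete_og n))"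
    by (rule finite_subset[of _ "Pow {1..n}"]) (use edges_complete_og in blast, simp)
  then show ?thesis
    by (simp add: colorings_def finite_PiE)
qed

lemma restrict_in_colorings:
  assumes "\<And>e. e \<in> edges (complete_og n) \<Longrightarrow> \<chi> e \<in> {1..k}"
  shows "restrict \<chi> (edges (complete_og n)) \<in> colorings k n"
  using assms by (auto simp: colorings_def)

lemma colorings_nonempty:
  assumes "k \<ge> 1"
  shows "colorings k n \<noteq> {}"
  using restrict_in_colorings[of n "\<lambda>_. 1" k] assms by auto

lemma ordered_mult_le:
  assumes "\<chi> \<in> colorings k n"
  shows "ordered_mult k w n G \<le> copy_weight k w n G \<chi>"
  using assms by (auto simp: ordered_mult_def copy_weight_def)

lemma ordered_mult_attained:
  assumes "k \<ge> 1"
  obtains \<chi> where "\<chi> \<in> colorings k n" "ordered_mult k w n G = copy_weight k w n G \<chi>"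
proof -
  have "ordered_mult k w n G \<in> copy_weight k w n G ` colorings k n"
    unfolding ordered_mult_def copy_weight_def[abs_def]
    by (rule Min_in) (use assms colorings_nonempty in auto)
  then show ?thesis
    using that by auto
qed

subsection \<open>Deleting a vertex\<close>

text \<open>For \<open>v\<close> in \<open>{1..Suc n}\<close> this is the increasing bijection from
  \<open>{1..n}\<close> onto \<open>{1..Suc n} - {v}\<close>. Colorings live on initial segments
  only, so the vertices that survive a deletion must be relabelled.\<close>

definition skip :: "nat \<Rightarrow> nat \<Rightarrow> nat" where
  "skip v x = (if x < v then x else Suc x)"

lemma skip_less_iff [simp]: "skip v x < skip v y \<longleftrightarrow> x < y"
  by (auto simp: skip_def)

lemma inj_skip: "inj_on (skip v) A"
  by (auto simp: skip_def inj_on_def split: if_splits)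

lemma skip_neq: "skip v x \<noteq> v"
  by (auto simp: skip_def)

lemma skip_in: "x \<in> {1..n} \<Longrightarrow> skip v x \<in> {1..Suc n}"
  by (auto simp: skip_def)

lemma skip_image_edge:
  assumes "e \<in> edges (complete_og n)"
  shows "skip v ` e \<in> edges (complete_og (Suc n))"
  using assms skip_in[of _ n v] by (auto simp: edges_complete_og card_image[OF inj_skip] subset_iff)

text \<open>The pullback of the coloring along \<open>skip v\<close>, that is, the coloring left
  after removing \<open>v\<close>. The \<open>restrict\<close> makes it extensional, as membership
  in \<open>colorings\<close> demands.\<close>

definition delete_coloring :: "nat \<Rightarrow> nat \<Rightarrow> (nat set \<Rightarrow> nat) \<Rightarrow> nat set \<Rightarrow> nat" where
  "delete_coloring n v \<chi> = restrict (\<lambda>e. \<chi> (skip v ` e)) (edges (complete_og n))"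

lemma delete_coloring_in_colorings:
  assumes "\<chi> \<in> colorings k (Suc n)"
  shows "delete_coloring n v \<chi> \<in> colorings k n"
  unfolding delete_coloring_def
  by (rule restrict_in_colorings) (use assms skip_image_edge in \<open>auto simp: colorings_def\<close>)

lemma mono_copy_skip:
  assumes "mono_copy n (delete_coloring n v \<chi>) i G f"
  shows "mono_copy (Suc n) \<chi> i G (skip v \<circ> f)"
proof -
  have f: "f \<in> verts G \<rightarrow> {1..n}" "inj_on f (verts G)"
    and less: "\<And>x y. (x, y) \<in> less_rel G \<Longrightarrow> f x \<in> {1..n} \<and> f y \<in> {1..n} \<and> f x < f y"
    and edge: "\<And>e. e \<in> edges G \<Longrightarrow> f ` e \<in> edges (complete_og n)"
    and color: "\<And>e. e \<in> edges G \<Longrightarrow> delete_coloring n v \<chi> (f ` e) = i"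
    using assms by (auto simp: mono_copy_def order_preserving_copy_def less_rel_complete_og)
  have "\<chi> (skip v ` f ` e) = i" if "e \<in> edges G" for e
    using edge[OF that] color[OF that] by (simp add: delete_coloring_def)
  moreover have "skip v \<circ> f \<in> verts G \<rightarrow> {1..Suc n}"
    using f(1) skip_in[of _ n v] by (fastforce simp: Pi_iff)
  moreover have "inj_on (skip v \<circ> f) (verts G)"
    using f(2) inj_skip by (rule comp_inj_on)
  moreover have "((skip v \<circ> f) x, (skip v \<circ> f) y) \<in> less_rel (complete_og (Suc n))"
    if "(x, y) \<in> less_rel G" for x y
    using less[OF that] skip_in[of _ n v] by (simp add: less_rel_complete_og del: atLeastAtMost_iff)
  moreover have "(skip v \<circ> f) ` e \<in> edges (complete_og (Suc n))" if "e \<in> edges G" for e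
    using skip_image_edge[OF edge[OF that]] by (simp add: image_comp)
  ultimately show ?thesis
    unfolding mono_copy_def order_preserving_copy_def verts_complete_og image_comp by blast
qed

text \<open>Taking images under the injective map \<open>skip v\<close> is itself injective on sets,
  and it carries copies in the deleted coloring to copies that avoid \<open>v\<close>.\<close>

lemma num_mono_copies_delete_le:
  "num_mono_copies n (delete_coloring n v \<chi>) i G \<le> card {T \<in> copy_sets (Suc n) \<chi> i G. v \<notin> T}"
proof -
  have "image (skip v) ` copy_sets n (delete_coloring n v \<chi>) i G
      \<subseteq> {T \<in> copy_sets (Suc n) \<chi> i G. v \<notin> T}"
  proof (rule image_subsetI)
    fix S assume "S \<in> copy_sets n (delete_coloring n v \<chi>) i G"
    then obtain f where f: "S = f ` verts G" "mono_copy n (delete_coloring n v \<chi>) i G f"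
      by (auto simp: copy_sets_def)
    have "skip v ` S \<in> copy_sets (Suc n) \<chi> i G"
      unfolding copy_sets_def f(1) image_comp using mono_copy_skip[OF f(2)] by blast
    moreover have "v \<notin> skip v ` S"
      using skip_neq by (metis imageE)
    ultimately show "skip v ` S \<in> {T \<in> copy_sets (Suc n) \<chi> i G. v \<notin> T}"
      by simp
  qed
  moreover have "inj_on (image (skip v)) A" for A
    by (metis inj_on_image inj_skip)
  ultimately show ?thesis
    unfolding num_mono_copies_eq_card by (intro card_inj_on_le[where f = "image (skip v)"]) auto
qed

text \<open>Double counting of the pairs of a vertex \<open>v\<close> and a copy \<open>T\<close>
  with \<open>v\<close> not in \<open>T\<close>: each copy is missed by exactly
  \<open>Suc n - order_of G\<close> vertices, hence by at most \<open>Suc n - h\<close>. Stating the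
  bound with a common \<open>h\<close> gives all colors the same factor, whatever the orders of
  their graphs.\<close>

lemma sum_num_mono_copies_delete_le:
  assumes "h \<le> order_of G"
  shows "(\<Sum>v\<in>{1..Suc n}. real (num_mono_copies n (delete_coloring n v \<chi>) i G))
    \<le> (real (Suc n) - real h) * real (num_mono_copies (Suc n) \<chi> i G)"
proof -
  let ?C = "copy_sets (Suc n) \<chi> i G"
  have "(\<Sum>v\<in>{1..Suc n}. num_mono_copies n (delete_coloring n v \<chi>) i G)
      \<le> (\<Sum>v\<in>{1..Suc n}. card {T \<in> ?C. v \<notin> T})"
    by (intro sum_mono num_mono_copies_delete_le)
  also have "\<dots> = (\<Sum>T\<in>?C. card {v \<in> {1..Suc n}. v \<notin> T})"
    by (rule sum_multicount_gen) (auto simp: finite_copy_sets)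
  also have "real \<dots> \<le> (\<Sum>T\<in>?C. real (Suc n) - real h)"
    unfolding of_nat_sum
  proof (rule sum_mono)
    fix T assume "T \<in> ?C"
    then have T: "T \<subseteq> {1..Suc n}" "card T = order_of G"
      using copy_sets_subset by blast+
    have "{v \<in> {1..Suc n}. v \<notin> T} = {1..Suc n} - T" by auto
    \<comment> \<open>This keeps the subtraction of natural numbers from truncating when it is moved
      to the reals.\<close>
    moreover have "card T \<le> Suc n"
      using card_mono[OF _ T(1)] by simp
    ultimately show "real (card {v \<in> {1..Suc n}. v \<notin> T}) \<le> real (Suc n) - real h"
      using T assms by (simp add: card_Diff_subset finite_subset[OF T(1)] of_nat_diff)
  qed
  also have "\<dots> = (real (Suc n) - real h) * real (num_mono_copies (Suc n) \<chi> i G)"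
    by (simp add: num_mono_copies_eq_card)
  finally show ?thesis by simp
qed

text \<open>Averaging: start from an optimal coloring on \<open>Suc n\<close> vertices. Each of its
  \<open>Suc n\<close> vertex deletions competes in the minimum for \<open>n\<close>, and the
  previous double count bounds their total weight.\<close>

lemma ordered_mult_Suc:
  assumes "k \<ge> 1" and w: "\<And>i. i \<in> {1..k} \<Longrightarrow> w i \<ge> 0"
    and h: "\<And>i. i \<in> {1..k} \<Longrightarrow> h \<le> order_of (G i)"
  shows "real (Suc n) * ordered_mult k w n G
    \<le> (real (Suc n) - real h) * ordered_mult k w (Suc n) G"
proof -
  obtain \<chi> where \<chi>: "\<chi> \<in> colorings k (Suc n)"
      "ordered_mult k w (Suc n) G = copy_weight k w (Suc n) G \<chi>"
    using ordered_mult_attained[OF assms(1)] .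
  have "real (Suc n) * ordered_mult k w n G = (\<Sum>v\<in>{1..Suc n}. ordered_mult k w n G)"
    by simp
  also have "\<dots> \<le> (\<Sum>v\<in>{1..Suc n}. copy_weight k w n G (delete_coloring n v \<chi>))"
    by (intro sum_mono ordered_mult_le delete_coloring_in_colorings \<chi>)
  also have "\<dots> = (\<Sum>i\<in>{1..k}. w i *
      (\<Sum>v\<in>{1..Suc n}. real (num_mono_copies n (delete_coloring n v \<chi>) i (G i))))"
    unfolding copy_weight_def sum_distrib_left by (rule sum.swap)
  also have "\<dots> \<le> (\<Sum>i\<in>{1..k}. w i *
      ((real (Suc n) - real h) * real (num_mono_copies (Suc n) \<chi> i (G i))))"
    by (intro sum_mono mult_left_mono sum_num_mono_copies_delete_le w h)
  also have "\<dots> = (real (Suc n) - real h) * ordered_mult k w (Suc n) G"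
    unfolding \<chi>(2) copy_weight_def sum_distrib_left by (simp add: algebra_simps)
  finally show ?thesis .
qed

lemma ordered_mult_ratio_Suc:
  assumes "k \<ge> 1" "\<And>i. i \<in> {1..k} \<Longrightarrow> w i \<ge> 0"
    and "\<And>i. i \<in> {1..k} \<Longrightarrow> h \<le> order_of (G i)" and "h \<le> n"
  shows "ordered_mult k w n G / real (n choose h)
    \<le> ordered_mult k w (Suc n) G / real (Suc n choose h)"
proof -
  \<comment> \<open>The absorption identity turns the averaging factor into the quotient of the two
    binomial coefficients, so multiplying by \<open>Suc n choose h\<close> and cancelling
    \<open>Suc n\<close> leaves a comparison of ratios.\<close>
  have binom: "(real (Suc n) - real h) * real (Suc n choose h) = real (Suc n) * real (n choose h)"
    using binomial_absorb_comp[of "Suc n" h] \<open>h \<le> n\<close>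
    by (metis diff_Suc_1 le_SucI of_nat_diff of_nat_mult)
  have pos: "real (n choose h) > 0" "real (Suc n choose h) > 0"
    using \<open>h \<le> n\<close> by simp_all
  have "real (Suc n) * (ordered_mult k w n G * real (Suc n choose h))
      \<le> (real (Suc n) - real h) * ordered_mult k w (Suc n) G * real (Suc n choose h)"
    unfolding mult.assoc[symmetric] using ordered_mult_Suc[OF assms(1-3)]
    by (intro mult_right_mono) auto
  also have "\<dots> = real (Suc n) * (ordered_mult k w (Suc n) G * real (n choose h))"
    using binom by (metis mult.assoc mult.commute)
  finally have "ordered_mult k w n G * real (Suc n choose h)
      \<le> ordered_mult k w (Suc n) G * real (n choose h)"
    by (simp only: mult_le_cancel_left_pos of_nat_0_less_iff zero_less_Suc)
  then show ?thesis
    using pos by (simp add: divide_simps del: binomial_Suc_Suc)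
qed

subsection \<open>Upper bound\<close>

text \<open>Any edge of \<open>G\<close> would have to receive both colors \<open>i\<close> and
  \<open>j\<close>. An edgeless graph would satisfy the color condition vacuously, which is why an
  edge is required.\<close>

lemma num_mono_copies_const:
  assumes "edges G \<noteq> {}" "i \<noteq> j"
  shows "num_mono_copies n (restrict (\<lambda>_. j) (edges (complete_og n))) i G = 0"
proof -
  have "\<not> mono_copy n (restrict (\<lambda>_. j) (edges (complete_og n))) i G f" for f
    using assms by (auto simp: mono_copy_def order_preserving_copy_def)
  then show ?thesis
    by (simp add: num_mono_copies_def)
qed

text \<open>In the constant coloring with color \<open>j\<close> only the summand of
  \<open>j\<close> survives. Later \<open>j\<close> is a color of smallest order and, among those,
  of least weight.\<close>

lemma ordered_mult_le_binomial:
  assumes edges: "\<And>i. i \<in> {1..k} \<Longrightarrow> edges (G i) \<noteq> {}"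
    and j: "j \<in> {1..k}" "w j \<ge> 0"
  shows "ordered_mult k w n G \<le> w j * real (n choose order_of (G j))"
proof -
  let ?\<chi> = "restrict (\<lambda>_. j) (edges (complete_og n))"
  have "ordered_mult k w n G \<le> copy_weight k w n G ?\<chi>"
    by (intro ordered_mult_le restrict_in_colorings) (use j in auto)
  also have "\<dots> = (\<Sum>i\<in>{1..k}. if i = j then w j * real (num_mono_copies n ?\<chi> j (G j)) else 0)"
    unfolding copy_weight_def
    by (intro sum.cong refl) (simp add: num_mono_copies_const[OF edges])
  also have "\<dots> = w j * real (num_mono_copies n ?\<chi> j (G j))"
    using j by simp
  also have "\<dots> \<le> w j * real (n choose order_of (G j))"
    using j num_mono_copies_le by (intro mult_left_mono) auto
  finally show ?thesis .
qed

subsection \<open>The ordered Ramsey number\<close>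

text \<open>A finite linear order is determined by its size: send the vertex with exactly
  \<open>r\<close> predecessors to the entry at index \<open>r\<close>, counted from 0, of the
  sorted list of \<open>H\<close>.\<close>

lemma order_preserving_embedding:
  fixes H :: "'b::linorder set"
  assumes G: "is_ordered_graph G" and H: "finite H" "card H = order_of G"
  obtains f where "f \<in> verts G \<rightarrow> H" "inj_on f (verts G)"
    "\<And>x y. (x, y) \<in> less_rel G \<Longrightarrow> f x < f y"
proof -
  define rank where "rank x = card {y. (y, x) \<in> less_rel G}" for x
  define f where "f x = sorted_list_of_set H ! rank x" for x
  have fin: "finite (verts G)" and sub: "less_rel G \<subseteq> verts G \<times> verts G"
    and trans: "trans (less_rel G)" and irrefl: "irrefl (less_rel G)"
    and total: "total_on (verts G) (less_rel G)"
    using G by (auto simp: is_ordered_graph_def strict_linear_order_on_def)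
  have below_fin: "finite {y. (y, x) \<in> less_rel G}" for x
    by (rule finite_subset[OF _ fin]) (use sub in auto)
  \<comment> \<open>By irreflexivity \<open>x\<close> is not among its own predecessors, so they
    form a proper subset of the vertices and \<open>rank x\<close> is a valid index.\<close>
  have rank_less: "rank x < card (verts G)" if "x \<in> verts G" for x
    unfolding rank_def
    by (rule psubset_card_mono[OF fin]) (use sub irrefl that in \<open>auto simp: irrefl_def\<close>)
  have rank_mono: "rank x < rank y" if "(x, y) \<in> less_rel G" for x y
    unfolding rank_def
  proof (rule psubset_card_mono[OF below_fin], rule psubsetI)
    show "{z. (z, x) \<in> less_rel G} \<subseteq> {z. (z, y) \<in> less_rel G}"
      using trans that by (auto dest: transD)
    \<comment> \<open>The vertex \<open>x\<close> separates the two sets.\<close>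
    show "{z. (z, x) \<in> less_rel G} \<noteq> {z. (z, y) \<in> less_rel G}"
      using irrefl that by (auto simp: irrefl_def)
  qed
  have len: "length (sorted_list_of_set H) = card (verts G)"
    using H by (simp add: order_of_def)
  have f_mono: "f x < f y" if "(x, y) \<in> less_rel G" for x y
    unfolding f_def
    by (rule sorted_wrt_nth_less[OF strict_sorted_list_of_set rank_mono[OF that]])
      (use len rank_less sub that in auto)
  have "f \<in> verts G \<rightarrow> H"
  proof
    fix x assume "x \<in> verts G"
    then have "f x \<in> set (sorted_list_of_set H)"
      unfolding f_def by (intro nth_mem) (simp only: len rank_less)
    then show "f x \<in> H"
      using H by simp
  qed
  \<comment> \<open>Totality makes distinct vertices comparable, and strict monotonicity then
    separates their images.\<close>
  moreover have "inj_on f (verts G)"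
    using total f_mono by (fastforce simp: inj_on_def total_on_def)
  ultimately show ?thesis
    using that f_mono by blast
qed

text \<open>Reduction to the multicolor Ramsey theorem for cliques: a clique in color
  \<open>i\<close> with \<open>order_of (G i)\<close> vertices contains \<open>G i\<close> in an
  order-preserving way, since any vertex order fits into it and all pairs are edges of the right
  color.\<close>

lemma ordered_ramsey_exists:
  assumes G: "\<And>i. i \<in> {1..k} \<Longrightarrow> is_ordered_graph (G i)"
  shows "\<exists>N. \<forall>\<chi>\<in>colorings k N. \<exists>i\<in>{1..k}. \<exists>f. mono_copy N \<chi> i (G i) f"
proof -
  \<comment> \<open>Ramsey's theorem is used with colors and vertices numbered from 0, while
    \<open>colorings\<close> starts both at 1; all occurrences of \<open>Suc\<close> and
    \<open>- 1\<close> below translate between the two.\<close>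
  let ?q = "map (\<lambda>i. order_of (G (Suc i))) [0..<k]"
  obtain N :: nat where N: "partn_lst {..<N} ?q 2"
    using ramsey_full by blast
  have "\<exists>i\<in>{1..k}. \<exists>f. mono_copy N \<chi> i (G i) f" if \<chi>: "\<chi> \<in> colorings k N" for \<chi>
  proof -
    have Suc_edge: "Suc ` e \<in> edges (complete_og N)" if "e \<in> nsets {..<N} 2" for e
      using that by (auto simp: nsets_def edges_complete_og card_image)
    have \<chi>_range: "\<chi> (Suc ` e) \<in> {1..k}" if "e \<in> nsets {..<N} 2" for e
      using \<chi> Suc_edge[OF that] by (auto simp: colorings_def)
    then have "(\<lambda>e. \<chi> (Suc ` e) - 1) \<in> nsets {..<N} 2 \<rightarrow> {..<k}"
      by fastforce
    then obtain i H where i: "i < length ?q" and H: "H \<in> nsets {..<N} (?q ! i)"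
      and mono: "(\<lambda>e. \<chi> (Suc ` e) - 1) ` nsets H 2 \<subseteq> {i}"
      by (rule partn_lstE[OF N]) auto
    have i: "Suc i \<in> {1..k}" using i by simp
    have H: "H \<subseteq> {..<N}" "finite H" "card H = order_of (G (Suc i))"
      using H i by (auto simp: nsets_def)
    obtain g where g: "g \<in> verts (G (Suc i)) \<rightarrow> H" "inj_on g (verts (G (Suc i)))"
        "\<And>x y. (x, y) \<in> less_rel (G (Suc i)) \<Longrightarrow> g x < g y"
      using order_preserving_embedding[OF G[OF i] H(2,3)] by blast
    have less: "x \<in> verts (G (Suc i)) \<and> y \<in> verts (G (Suc i))"
      if "(x, y) \<in> less_rel (G (Suc i))" for x y
      using G[OF i] that by (auto simp: is_ordered_graph_def)
    have ge: "g ` e \<in> nsets H 2" if "e \<in> edges (G (Suc i))" for e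
    proof -
      have "e \<subseteq> verts (G (Suc i))" "card e = 2"
        using G[OF i] that by (auto simp: is_ordered_graph_def)
      moreover from this have "finite e"
        using card.infinite by force
      ultimately show ?thesis
        using g(1,2) by (auto simp: nsets_def card_image inj_on_subset)
    qed
    have ge': "g ` e \<in> nsets {..<N} 2" if "e \<in> edges (G (Suc i))" for e
      using ge[OF that] nsets_mono[OF H(1)] by blast
    have "\<chi> (Suc ` g ` e) = Suc i" if "e \<in> edges (G (Suc i))" for e
    proof -
      have "\<chi> (Suc ` g ` e) - 1 = i"
        using mono ge[OF that] by blast
      \<comment> \<open>Subtraction truncates at 0, so the color can be recovered from its
        predecessor only because it is at least 1.\<close>
      moreover have "\<chi> (Suc ` g ` e) \<ge> 1"
        using \<chi>_range[OF ge'[OF that]] by simp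
      ultimately show ?thesis by linarith
    qed
    moreover have "Suc \<circ> g \<in> verts (G (Suc i)) \<rightarrow> {1..N}"
      using g(1) H(1) by (auto simp: Pi_iff subset_iff Suc_le_eq)
    moreover have "inj_on (Suc \<circ> g) (verts (G (Suc i)))"
      using g(2) by (intro comp_inj_on) auto
    moreover have "(Suc \<circ> g) x \<in> {1..N} \<and> (Suc \<circ> g) y \<in> {1..N} \<and> (Suc \<circ> g) x < (Suc \<circ> g) y"
      if "(x, y) \<in> less_rel (G (Suc i))" for x y
      using g(3)[OF that] less[OF that] calculation(2) by (simp add: Pi_iff)
    moreover have "Suc ` g ` e \<in> edges (complete_og N)" if "e \<in> edges (G (Suc i))" for e
      using Suc_edge[OF ge'[OF that]] .
    ultimately have "mono_copy N \<chi> (Suc i) (G (Suc i)) (Suc \<circ> g)"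
      unfolding mono_copy_def order_preserving_copy_def less_rel_complete_og verts_complete_og
        image_comp
      by blast
    then show ?thesis
      using i by blast
  qed
  then show ?thesis by blast
qed

text \<open>Existence of some suitable number is what lets the \<open>LEAST\<close> inherit the
  defining property.\<close>

lemma ordered_ramsey_mono_copy:
  assumes "\<And>i. i \<in> {1..k} \<Longrightarrow> is_ordered_graph (G i)" and "\<chi> \<in> colorings k (ordered_ramsey k G)"
  shows "\<exists>i\<in>{1..k}. \<exists>f. mono_copy (ordered_ramsey k G) \<chi> i (G i) f"
  using LeastI_ex[OF ordered_ramsey_exists[where k = k and G = G, OF assms(1)]] assms(2)
  unfolding ordered_ramsey_def by blast

text \<open>A copy found at the Ramsey number has to fit into its vertices. This makes
  \<open>n choose h\<close> positive from the Ramsey number on, so that no ratio divides by zero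
  there.\<close>

lemma order_of_le_ordered_ramsey:
  assumes "k \<ge> 1" "\<And>i. i \<in> {1..k} \<Longrightarrow> is_ordered_graph (G i)"
  shows "\<exists>i\<in>{1..k}. order_of (G i) \<le> ordered_ramsey k G"
proof -
  obtain \<chi> where "\<chi> \<in> colorings k (ordered_ramsey k G)"
    using colorings_nonempty[OF assms(1)] by blast
  then obtain i f where i: "i \<in> {1..k}" and f: "mono_copy (ordered_ramsey k G) \<chi> i (G i) f"
    using ordered_ramsey_mono_copy[where k = k and G = G, OF assms(2)] by blast
  have "card (f ` verts (G i)) \<le> card {1..ordered_ramsey k G}"
    by (rule card_mono) (use mono_copyD(1)[OF f] in auto)
  then show ?thesis
    using i mono_copyD(2)[OF f] by (auto simp: order_of_def card_image)
qed

lemma threshold_mult_pos: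
  assumes "k \<ge> 1" "\<And>i. i \<in> {1..k} \<Longrightarrow> is_ordered_graph (G i)"
    and w: "\<And>i. i \<in> {1..k} \<Longrightarrow> w i > 0"
  shows "threshold_mult k w G > 0"
proof -
  obtain \<chi> where \<chi>: "\<chi> \<in> colorings k (ordered_ramsey k G)"
      "threshold_mult k w G = copy_weight k w (ordered_ramsey k G) G \<chi>"
    using ordered_mult_attained[OF assms(1)] unfolding threshold_mult_def by blast
  obtain i f where i: "i \<in> {1..k}" and f: "mono_copy (ordered_ramsey k G) \<chi> i (G i) f"
    using ordered_ramsey_mono_copy[where k = k and G = G, OF assms(2) \<chi>(1)] by blast
  show ?thesis
    unfolding \<chi>(2) copy_weight_def
    using i w num_mono_copies_pos[OF f] by (intro sum_pos2[OF _ i]) (auto simp: less_imp_le)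
qed

subsection \<open>The limit\<close>

text \<open>Monotone convergence applied to the tail that starts at \<open>R\<close>; shifting the
  index does not change the limit.\<close>

lemma mono_bounded_from_tendsto:
  fixes f :: "nat \<Rightarrow> real"
  assumes mono: "mono_on {R..} f" and bound: "\<And>n. n \<ge> R \<Longrightarrow> f n \<le> B"
  shows "f \<longlonglongrightarrow> lim f" and "f R \<le> lim f" and "lim f \<le> B"
proof -
  have inc: "incseq (\<lambda>n. f (n + R))"
    using mono by (auto simp: incseq_def mono_on_def)
  then obtain L where L: "(\<lambda>n. f (n + R)) \<longlonglongrightarrow> L"
    using incseq_convergent[OF inc, of B] bound by (metis le_add2)
  then have "f \<longlonglongrightarrow> L"
    by (rule LIMSEQ_offset)
  then have lim: "lim f = L"
    by (rule limI)
  show "f \<longlonglongrightarrow> lim f"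
    using \<open>f \<longlonglongrightarrow> L\<close> lim by simp
  show "f R \<le> lim f"
    using incseq_le[OF inc L, of 0] lim by simp
  show "lim f \<le> B"
    unfolding lim by (rule LIMSEQ_le_const2[OF \<open>f \<longlonglongrightarrow> L\<close>]) (use bound in blast)
qed

text \<open>For \<open>n\<close> at least \<open>h\<close>, the binomial coefficient lies between
  \<open>(n / h) ^ h\<close> and \<open>n ^ h\<close>, so a ratio bounded between positive constants
  fixes the order of growth.\<close>

lemma bigtheta_power_if_binomial_ratio_bounded:
  fixes f :: "nat \<Rightarrow> real"
  assumes "c > 0" and bounds: "\<And>n. n \<ge> R \<Longrightarrow> c \<le> f n / real (n choose h) \<and> f n / real (n choose h) \<le> C"
  shows "f \<in> \<Theta>(\<lambda>n. real n ^ h)"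
proof (rule bigthetaI')
  \<comment> \<open>For \<open>h = 0\<close> the denominator is \<open>0 ^ 0 = 1\<close>, so the
    constant stays positive.\<close>
  show "c / real h ^ h > 0"
    using \<open>c > 0\<close> by (cases "h = 0") auto
  \<comment> \<open>The sign of \<open>C\<close> is not assumed; it follows from the two bounds at
    \<open>n = R\<close>.\<close>
  have "c \<le> C"
    using bounds[of R] by linarith
  then show "C > 0"
    using \<open>c > 0\<close> by linarith
  show "eventually (\<lambda>n. c / real h ^ h * norm (real n ^ h) \<le> norm (f n) \<and>
      norm (f n) \<le> C * norm (real n ^ h)) sequentially"
    using eventually_ge_at_top[of "max R h"]
  proof eventually_elim
    case (elim n)
    then have n: "R \<le> n" "h \<le> n" by auto
    have pos: "real (n choose h) > 0"
      using n by simp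
    have f: "c * real (n choose h) \<le> f n" "f n \<le> C * real (n choose h)"
      using bounds[OF n(1)] pos by (simp_all add: pos_le_divide_eq pos_divide_le_eq)
    have "c / real h ^ h * real n ^ h = c * (real n / real h) ^ h"
      by (simp add: power_divide)
    also have "\<dots> \<le> c * real (n choose h)"
      using \<open>c > 0\<close> binomial_ge_n_over_k_pow_k[OF n(2)] by (intro mult_left_mono) auto
    finally have lower: "c / real h ^ h * real n ^ h \<le> f n"
      using f by linarith
    have "real (n choose h) \<le> real n ^ h"
      using binomial_le_pow[OF n(2)] by (metis of_nat_le_iff of_nat_power)
    then have "f n \<le> C * real n ^ h"
      using f \<open>C > 0\<close> by (meson less_imp_le mult_left_mono order_trans)
    moreover have "f n \<ge> 0"
      using f(1) \<open>c > 0\<close> pos by (meson less_imp_le mult_pos_pos order_trans)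
    ultimately show ?case
      using lower by simp
  qed
qed

theorem corollary2p3:
  fixes k :: nat and G :: "nat \<Rightarrow> 'a ordered_graph" and w :: "nat \<Rightarrow> real"
    and R h :: nat and wmin :: real
  assumes "k \<ge> 1"
    and "\<And>i. i \<in> {1..k} \<Longrightarrow> is_ordered_graph (G i)"
    and "\<And>i. i \<in> {1..k} \<Longrightarrow> edges (G i) \<noteq> {}"
    and "\<And>i. i \<in> {1..k} \<Longrightarrow> w i > 0"
    and "R = ordered_ramsey k G"
    and "h = min_order k G"
    and "wmin = min_weight k w G"
  shows "mono_on {R..} (\<lambda>n. ordered_mult k w n G / real (n choose h)) \<and>
    (\<forall>n\<ge>R. ordered_mult k w n G / real (n choose h) \<le> wmin) \<and>
    (\<lambda>n. ordered_mult k w n G / real (n choose h)) \<longlonglongrightarrow> mult_limit k w G \<and>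
    0 < threshold_mult k w G / real (R choose h) \<and>
    threshold_mult k w G / real (R choose h) \<le> mult_limit k w G \<and>
    mult_limit k w G \<le> wmin \<and>
    (\<lambda>n. ordered_mult k w n G) \<in> \<Theta>(\<lambda>n. real n ^ h)"
proof -
  let ?r = "\<lambda>n. ordered_mult k w n G / real (n choose h)"
  have h_le: "h \<le> order_of (G i)" if "i \<in> {1..k}" for i
    unfolding \<open>h = min_order k G\<close> min_order_def using that by simp
  \<comment> \<open>The smallest order is attained, so the set of weights behind \<open>wmin\<close>
    is nonempty and its minimum is attained too; this supplies the color \<open>j\<close> for the
    constant coloring.\<close>
  have "h \<in> (\<lambda>i. order_of (G i)) ` {1..k}"
    unfolding \<open>h = min_order k G\<close> min_order_def by (rule Min_in) (use \<open>k \<ge> 1\<close> in auto)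
  then have "wmin \<in> w ` {i \<in> {1..k}. order_of (G i) = h}"
    unfolding \<open>wmin = min_weight k w G\<close> min_weight_def \<open>h = min_order k G\<close>[symmetric]
    by (intro Min_in) auto
  then obtain j where j: "j \<in> {1..k}" "order_of (G j) = h" "wmin = w j"
    by auto
  have hR: "h \<le> R"
    using order_of_le_ordered_ramsey[OF assms(1,2)] h_le \<open>R = ordered_ramsey k G\<close>
    by (meson order_trans)
  have bound: "?r n \<le> wmin" if "n \<ge> R" for n
    using ordered_mult_le_binomial[where G = G, OF assms(3) j(1), where w = w and n = n] assms(4)[OF j(1)] j that hR
    by (simp add: pos_divide_le_eq)
  have mono: "mono_on {R..} ?r"
  proof (rule mono_onI)
    fix m n :: nat assume "m \<in> {R..}" "n \<in> {R..}" "m \<le> n"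
    from \<open>m \<le> n\<close> show "?r m \<le> ?r n"
    \<comment> \<open>The one-vertex comparison is chained upwards from \<open>m\<close>; its
      condition \<open>h \<le> n\<close> holds because
      \<open>h \<le> R \<le> m \<le> n\<close>.\<close>
    proof (induction n rule: dec_induct)
      case (step n)
      have "h \<le> n"
        using step \<open>m \<in> {R..}\<close> hR by simp
      then show ?case
        using step.IH ordered_mult_ratio_Suc[OF assms(1) less_imp_le[OF assms(4)] h_le]
        by (meson order_trans)
    qed simp
  qed
  have lim: "mult_limit k w G = lim ?r"
    by (simp add: mult_limit_def mult_ratio_def[abs_def] \<open>h = min_order k G\<close>)
  \<comment> \<open>The threshold ratio is the first term of the monotone range, so its positivity
    bounds the whole tail and the limit away from 0.\<close>
  have threshold: "threshold_mult k w G / real (R choose h) = ?r R"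
    by (simp add: threshold_mult_def \<open>R = ordered_ramsey k G\<close>)
  have pos: "0 < ?r R"
    unfolding threshold[symmetric] using threshold_mult_pos[OF assms(1,2,4)] hR by simp
  have "(\<lambda>n. ordered_mult k w n G) \<in> \<Theta>(\<lambda>n. real n ^ h)"
    using pos bound mono
    by (intro bigtheta_power_if_binomial_ratio_bounded[where c = "?r R" and R = R and C = wmin])
      (auto simp: mono_on_def)
  then show ?thesis
    using mono bound pos mono_bounded_from_tendsto[OF mono bound] by (simp add: lim threshold)
qed

end
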